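(* Let $h_{\bm a,b}$ be a linear classifier on $\mathbb{R}^p$ with unknown parameters, and let $\bm{x}^{(i)}\in\mathbb{R}^p$, $i\in I$ ($I$ finite), be data points such that $\bm{x}^{(i)}$ is classified as 'No' for $i\in I_0$ and as 'Yes' for $i\in I_1$, where $I_0\cup I_1=I$ (disjoint). Let $\mathcal{X}_{No}$ and $\mathcal{X}_{Yes}$ be the 'No' and 'Yes' regions determined by these data (defined in the context). Then $$\mathcal{X}_{No}=\Big\{\bm{x}\in\mathbb{R}^p \;\Big|\; \exists\,\bm{u}\in\mathbb{R}^{|I|}:\ \sum_{i\in I_0}u_i-\sum_{i\in I_1}u_i=1,\ \sum_{i\in I_0}u_i\bm{x}^{(i)}-\sum_{i\in I_1}u_i\bm{x}^{(i)}=\bm{x},\ \bm{u}\ge\bm{0}\Big\}$$ and $$\mathcal{X}_{Yes}=\Big\{\bm{x}\in\mathbb{R}^p \;\Big|\; \exists\,\bm{u}\in\mathbb{R}^{|I|}:\ \sum_{i\in I_1}u_i-\sum_{i\in I_0}u_i=1,\ \sum_{i\in I_1}u_i\bm{x}^{(i)}-\sum_{i\in I_0}u_i\bm{x}^{(i)}=\bm{x},\ \bm{u}\ge\bm{0}\Big\}.$$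
   Context: A linear classifier with parameters $\bm a\in\mathbb{R}^p\setminus\{\bm 0\}$, $b\in\mathbb{R}$ is $h_{\bm a,b}:\mathbb{R}^p\to\{-1,1\}$ with $h_{\bm a,b}(\bm x)=1$ ('Yes') if $\bm a^\top\bm x-b\ge 0$ and $h_{\bm a,b}(\bm x)=-1$ ('No') if $\bm a^\top\bm x-b<0$. Given the classified data points, the set of possible parameters is the polyhedron $$\mathcal{U}^F_{\bm a,b}=\{(\bm a,b)\in\mathbb{R}^p\times\mathbb{R} \mid \bm a^\top\bm x^{(i)}-b\le 0\ \forall i\in I_0,\ \ \bm a^\top\bm x^{(i)}-b\ge 0\ \forall i\in I_1\}.$$ The regions are $$\mathcal{X}_{No}:=\{\bm x\in\mathbb{R}^p\mid \bm a^\top\bm x-b\le 0\ \ \forall (\bm a,b)\in\mathcal{U}^F_{\bm a,b}\},\qquad \mathcal{X}_{Yes}:=\{\bm x\in\mathbb{R}^p\mid \bm a^\top\bm x-b\ge 0\ \ \forall (\bm a,b)\in\mathcal{U}^F_{\bm a,b}\}.$$ *)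

theory Defs
  imports "HOL-Analysis.Analysis"
begin

text \<open>The requirement \<open>a \<noteq> 0\<close> on the parameters is not built into
  \<open>linear_classifier\<close>; it is to be assumed wherever a linear classifier is fixed.\<close>

definition linear_classifier :: "real ^ 'p \<Rightarrow> real \<Rightarrow> real ^ 'p \<Rightarrow> int" where
  "linear_classifier a b x = (if a \<bullet> x - b \<ge> 0 then 1 else - 1)"

text \<open>This is a closed cone: the inequalities are non-strict for the points labelled
  'No' as well, and \<open>a = 0\<close> is allowed.\<close>

definition feasible_params ::
    "('i \<Rightarrow> real ^ 'p) \<Rightarrow> 'i set \<Rightarrow> 'i set \<Rightarrow> ((real ^ 'p) \<times> real) set" where
  "feasible_params x I\<^sub>0 I\<^sub>1 =
     {(a, b). (\<forall>i\<in>I\<^sub>0. a \<bullet> x i - b \<le> 0) \<and> (\<forall>i\<in>I\<^sub>1. a \<bullet> x i - b \<ge> 0)}"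

definition No_region ::
    "('i \<Rightarrow> real ^ 'p) \<Rightarrow> 'i set \<Rightarrow> 'i set \<Rightarrow> (real ^ 'p) set" where
  "No_region x I\<^sub>0 I\<^sub>1 = {y. \<forall>(a, b)\<in>feasible_params x I\<^sub>0 I\<^sub>1. a \<bullet> y - b \<le> 0}"

definition Yes_region ::
    "('i \<Rightarrow> real ^ 'p) \<Rightarrow> 'i set \<Rightarrow> 'i set \<Rightarrow> (real ^ 'p) set" where
  "Yes_region x I\<^sub>0 I\<^sub>1 = {y. \<forall>(a, b)\<in>feasible_params x I\<^sub>0 I\<^sub>1. a \<bullet> y - b \<ge> 0}"

end

theory Submission
  imports Defs
begin

text \<open>Homogenise: \<open>a \<bullet> z - b\<close> is the inner product of \<open>(a, b)\<close> with \<open>(z, - 1)\<close>. So \<open>y\<close> lies in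
  the 'No' region iff \<open>(y, - 1)\<close> makes a nonpositive product with every vector that does so with
  all the \<open>(x i, - 1)\<close> for \<open>i \<in> I\<^sub>0\<close> and \<open>- (x i, - 1)\<close> for \<open>i \<in> I\<^sub>1\<close>. By Farkas' lemma
  this says that \<open>(y, - 1)\<close> is a nonnegative combination of these vectors. The 'Yes' region is the
  'No' region with the labels exchanged, by \<open>(a, b) \<mapsto> (- a, - b)\<close>.\<close>

text \<open>The combinations form a convex cone containing every generator, so minimality of the
  hull applies. Coefficients are indexed by \<open>I\<close> and not by the image, so
  \<open>g\<close> need not be injective.\<close>

lemma convex_cone_hull_image_subset:
  fixes g :: "'i \<Rightarrow> 'a::real_vector"
  assumes "finite I"
  shows "convex_cone hull (g ` I) \<subseteq> {\<Sum>i\<in>I. u i *\<^sub>R g i | u. \<forall>i\<in>I. 0 \<le> u i}"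
    (is "_ \<subseteq> ?C")
proof (rule hull_minimal)
  show "g ` I \<subseteq> ?C"
  proof
    fix z assume "z \<in> g ` I"
    then obtain j where j: "j \<in> I" "z = g j" by blast
    have "z = (\<Sum>i\<in>I. (if i = j then 1 else 0) *\<^sub>R g i)"
      using j assms by (simp add: if_distrib[of "\<lambda>c. c *\<^sub>R _"] cong: if_cong)
    then show "z \<in> ?C" by (intro CollectI exI[of _ "\<lambda>i. if i = j then 1 else 0"]) auto
  qed
  show "convex_cone ?C"
    unfolding convex_cone_iff
  proof (intro conjI ballI allI impI)
    show "0 \<in> ?C" by (intro CollectI exI[of _ "\<lambda>_. 0"]) auto
  next
    fix y z assume "y \<in> ?C" "z \<in> ?C"
    then obtain u v where "y = (\<Sum>i\<in>I. u i *\<^sub>R g i)" "z = (\<Sum>i\<in>I. v i *\<^sub>R g i)"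
      "\<forall>i\<in>I. 0 \<le> u i" "\<forall>i\<in>I. 0 \<le> v i" by blast
    then show "y + z \<in> ?C"
      by (intro CollectI exI[of _ "\<lambda>i. u i + v i"]) (auto simp: scaleR_add_left sum.distrib)
  next
    fix y and c :: real assume "y \<in> ?C" "0 \<le> c"
    then obtain u where "y = (\<Sum>i\<in>I. u i *\<^sub>R g i)" "\<forall>i\<in>I. 0 \<le> u i" by blast
    with \<open>0 \<le> c\<close> show "c *\<^sub>R y \<in> ?C"
      by (intro CollectI exI[of _ "\<lambda>i. c * u i"]) (auto simp: scaleR_sum_right)
  qed
qed

text \<open>A finitely generated cone is closed, so a point outside it is strictly separated from
  it. Scaling inside the cone moves the separating threshold to 0, and the negated normal then
  violates \<open>polar\<close>.\<close>

lemma farkas: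
  fixes g :: "'i \<Rightarrow> 'a::euclidean_space"
  assumes "finite I" and polar: "\<And>c. \<forall>i\<in>I. c \<bullet> g i \<le> 0 \<Longrightarrow> c \<bullet> z \<le> 0"
  obtains u where "\<forall>i\<in>I. 0 \<le> u i" "z = (\<Sum>i\<in>I. u i *\<^sub>R g i)"
proof -
  let ?K = "convex_cone hull (g ` I)"
  have "z \<in> ?K"
  proof (rule ccontr)
    assume "z \<notin> ?K"
    moreover have "closed ?K" using \<open>finite I\<close> by (simp add: closed_convex_cone_hull)
    ultimately obtain c d where z: "c \<bullet> z < d" and K: "\<forall>w\<in>?K. d < c \<bullet> w"
      using separating_hyperplane_closed_point[OF convex_convex_cone_hull] by blast
    have "d < 0" using K convex_cone_hull_contains_0 by fastforce
    have "0 \<le> c \<bullet> g i" if "i \<in> I" for i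
    proof (rule ccontr)
      assume neg: "\<not> 0 \<le> c \<bullet> g i"
      \<comment> \<open>Both \<open>d\<close> and \<open>c \<bullet> g i\<close> are negative, so
        the factor is positive; it is chosen to make the product with \<open>c\<close> exactly
        \<open>d\<close>, against the strict bound in \<open>K\<close>.\<close>
      have "(d / (c \<bullet> g i)) *\<^sub>R g i \<in> ?K"
        using that neg \<open>d < 0\<close>
        by (intro convex_cone_hull_mul hull_inc) (auto simp: divide_nonpos_neg)
      then have "d < c \<bullet> ((d / (c \<bullet> g i)) *\<^sub>R g i)" using K by blast
      with neg show False by simp
    qed
    with polar[of "- c"] z \<open>d < 0\<close> show False by simp
  qed
  then show thesis using convex_cone_hull_image_subset[OF \<open>finite I\<close>, of g] that by blast
qed

lemma No_region_eq:
  fixes x :: "'i \<Rightarrow> real ^ 'p"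
  assumes fin: "finite (A \<union> B)" and disj: "A \<inter> B = {}"
  shows "No_region x A B =
    {y. \<exists>u :: 'i \<Rightarrow> real. (\<Sum>i\<in>A. u i) - (\<Sum>i\<in>B. u i) = 1 \<and>
          (\<Sum>i\<in>A. u i *\<^sub>R x i) - (\<Sum>i\<in>B. u i *\<^sub>R x i) = y \<and> (\<forall>i\<in>A \<union> B. u i \<ge> 0)}"
    (is "_ = ?R")
proof (intro equalityI subsetI)
  fix y assume y: "y \<in> No_region x A B"
  \<comment> \<open>The labels become signs, giving a single family for \<open>farkas\<close>.
    Disjointness ensures that indices in \<open>B\<close> get the second form.\<close>
  define g where "g i = (if i \<in> A then (x i, - 1 :: real) else (- x i, 1))" for i
  have A: "g i = (x i, - 1)" if "i \<in> A" for i using that by (simp add: g_def)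
  have B: "g i = (- x i, 1)" if "i \<in> B" for i using that disj by (auto simp: g_def)
  have polar: "c \<bullet> (y, - 1) \<le> 0" if c: "\<forall>i\<in>A \<union> B. c \<bullet> g i \<le> 0" for c
  proof -
    obtain a b where ab: "c = (a, b)" by fastforce
    have "a \<bullet> x i - b \<le> 0" if "i \<in> A" for i
      using c[rule_format, of i] that by (simp add: ab A)
    moreover have "0 \<le> a \<bullet> x i - b" if "i \<in> B" for i
      using c[rule_format, of i] that by (simp add: ab B)
    ultimately have "(a, b) \<in> feasible_params x A B"
      by (auto simp: feasible_params_def)
    then show ?thesis using y by (auto simp: No_region_def ab)
  qed
  obtain u where u: "\<forall>i\<in>A \<union> B. 0 \<le> u i" "(y, - 1) = (\<Sum>i\<in>A \<union> B. u i *\<^sub>R g i)"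
    using farkas[OF fin polar] by blast
  have "(\<Sum>i\<in>A \<union> B. u i *\<^sub>R g i) = (\<Sum>i\<in>A. u i *\<^sub>R g i) + (\<Sum>i\<in>B. u i *\<^sub>R g i)"
    using fin disj by (simp add: sum.union_disjoint)
  also have "\<dots> = (\<Sum>i\<in>A. (u i *\<^sub>R x i, - u i)) + (\<Sum>i\<in>B. (- (u i *\<^sub>R x i), u i))"
    by (intro arg_cong2[where f = "(+)"] sum.cong) (simp_all add: A B)
  \<comment> \<open>Comparison with \<open>(y, - 1)\<close>: the first coordinate represents
    \<open>y\<close>, the second normalises the weights.\<close>
  also have "\<dots> = ((\<Sum>i\<in>A. u i *\<^sub>R x i) - (\<Sum>i\<in>B. u i *\<^sub>R x i),
                   - ((\<Sum>i\<in>A. u i) - (\<Sum>i\<in>B. u i)))"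
    by (simp add: sum_prod sum_negf)
  finally show "y \<in> ?R" using u by (intro CollectI exI[of _ u]) simp
next
  fix y assume "y \<in> ?R"
  then obtain u :: "'i \<Rightarrow> real" where u: "(\<Sum>i\<in>A. u i) - (\<Sum>i\<in>B. u i) = 1"
    "y = (\<Sum>i\<in>A. u i *\<^sub>R x i) - (\<Sum>i\<in>B. u i *\<^sub>R x i)" "\<forall>i\<in>A \<union> B. 0 \<le> u i" by blast
  show "y \<in> No_region x A B"
    unfolding No_region_def feasible_params_def
  proof clarsimp
    fix a b assume A: "\<forall>i\<in>A. a \<bullet> x i \<le> b" and B: "\<forall>i\<in>B. b \<le> a \<bullet> x i"
    \<comment> \<open>Weak duality: the coefficient 1 of \<open>b\<close> is written as the
      difference of the weight sums, so that \<open>b\<close> can be distributed over the data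
      points.\<close>
    have "a \<bullet> y - b = (\<Sum>i\<in>A. u i * (a \<bullet> x i)) - (\<Sum>i\<in>B. u i * (a \<bullet> x i))
                       - ((\<Sum>i\<in>A. u i) - (\<Sum>i\<in>B. u i)) * b"
      unfolding u(1) by (simp add: u(2) inner_diff_right inner_sum_right)
    also have "\<dots> = (\<Sum>i\<in>A. u i * (a \<bullet> x i - b)) - (\<Sum>i\<in>B. u i * (a \<bullet> x i - b))"
      by (simp add: right_diff_distrib left_diff_distrib sum_subtractf sum_distrib_right)
    also have "\<dots> \<le> 0"
    proof -
      have "(\<Sum>i\<in>A. u i * (a \<bullet> x i - b)) \<le> 0"
        using u(3) A by (intro sum_nonpos mult_nonneg_nonpos) auto
      moreover have "0 \<le> (\<Sum>i\<in>B. u i * (a \<bullet> x i - b))"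
        using u(3) B by (intro sum_nonneg mult_nonneg_nonneg) auto
      ultimately show ?thesis by linarith
    qed
    finally show "a \<bullet> y \<le> b" by simp
  qed
qed

lemma feasible_params_uminus:
  "(- a, - b) \<in> feasible_params x A B \<longleftrightarrow> (a, b) \<in> feasible_params x B A"
  by (auto simp: feasible_params_def)

lemma Yes_region_eq_No_region: "Yes_region x A B = No_region x B A"
proof (intro equalityI subsetI)
  fix y assume y: "y \<in> Yes_region x A B"
  have "a \<bullet> y - b \<le> 0" if "(a, b) \<in> feasible_params x B A" for a b
  proof -
    have "(- a, - b) \<in> feasible_params x A B" using that by (simp add: feasible_params_uminus)
    then have "0 \<le> (- a) \<bullet> y - (- b)" using y by (force simp: Yes_region_def)
    then show ?thesis by simp
  qed
  then show "y \<in> No_region x B A" by (force simp: No_region_def)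
next
  fix y assume y: "y \<in> No_region x B A"
  have "0 \<le> a \<bullet> y - b" if "(a, b) \<in> feasible_params x A B" for a b
  proof -
    have "(- a, - b) \<in> feasible_params x B A" using that by (simp add: feasible_params_uminus)
    then have "(- a) \<bullet> y - (- b) \<le> 0" using y by (force simp: No_region_def)
    then show ?thesis by simp
  qed
  then show "y \<in> Yes_region x A B" by (force simp: Yes_region_def)
qed

theorem theorem5:
  fixes a :: "real ^ 'p" and b :: real
    and x :: "'i \<Rightarrow> real ^ 'p" and I I\<^sub>0 I\<^sub>1 :: "'i set"
  assumes "a \<noteq> 0"
    and "finite I"
    and "I\<^sub>0 \<union> I\<^sub>1 = I"
    and "I\<^sub>0 \<inter> I\<^sub>1 = {}"
    and "\<forall>i\<in>I\<^sub>0. linear_classifier a b (x i) = - 1"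
    and "\<forall>i\<in>I\<^sub>1. linear_classifier a b (x i) = 1"
  shows "No_region x I\<^sub>0 I\<^sub>1 =
           {y. \<exists>u :: 'i \<Rightarrow> real.
                 (\<Sum>i\<in>I\<^sub>0. u i) - (\<Sum>i\<in>I\<^sub>1. u i) = 1 \<and>
                 (\<Sum>i\<in>I\<^sub>0. u i *\<^sub>R x i) - (\<Sum>i\<in>I\<^sub>1. u i *\<^sub>R x i) = y \<and>
                 (\<forall>i\<in>I. u i \<ge> 0)} \<and>
         Yes_region x I\<^sub>0 I\<^sub>1 =
           {y. \<exists>u :: 'i \<Rightarrow> real.
                 (\<Sum>i\<in>I\<^sub>1. u i) - (\<Sum>i\<in>I\<^sub>0. u i) = 1 \<and>
                 (\<Sum>i\<in>I\<^sub>1. u i *\<^sub>R x i) - (\<Sum>i\<in>I\<^sub>0. u i *\<^sub>R x i) = y \<and>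
                 (\<forall>i\<in>I. u i \<ge> 0)}"
proof -
  \<comment> \<open>The swapped forms serve the 'Yes' half, where \<open>No_region_eq\<close> is
    used with the labels exchanged.\<close>
  have "finite (I\<^sub>0 \<union> I\<^sub>1)" "finite (I\<^sub>1 \<union> I\<^sub>0)" "I\<^sub>1 \<inter> I\<^sub>0 = {}" "I\<^sub>1 \<union> I\<^sub>0 = I"
    using assms by auto
  then show ?thesis
    unfolding Yes_region_eq_No_region using assms(3,4) by (simp only: No_region_eq)
qed

end
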